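(* For every integer $l\ge 2$, $$(1+o(1))\,4\,\frac{m^{l+1}}{(2l+2)^{l+1}} \le \rho(P_{2l+1},m) \le \frac{m^{l+1}}{4\,l^{l}},$$ where the upper bound holds for every positive integer $m$, and in the lower bound $o(1)$ denotes a quantity tending to $0$ as $m\to\infty$ with $l$ fixed.
   Context: Graphs are finite, simple and undirected. $P_k$ denotes the path on $k$ vertices. For graphs $G$ and $H$, $c(G,H)$ is the number of induced copies of $H$ in $G$, i.e. the number of subsets $S\subseteq V(G)$ such that the induced subgraph $G[S]$ is isomorphic to $H$. For a positive integer $m$, $\rho(H,m)=\max\{c(G,H) : G \text{ a graph with } |E(G)|=m\}$ (the number of vertices of $G$ is not restricted). *)

theory Defs
  imports Complex_Main
begin

text \<open>A graph is a pair of a vertex set and a set of edges, each edge being a two-element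
  set of vertices.\<close>

type_synonym 'a graph = "'a set \<times> 'a set set"

abbreviation verts :: "'a graph \<Rightarrow> 'a set" where
  "verts G \<equiv> fst G"

abbreviation edges :: "'a graph \<Rightarrow> 'a set set" where
  "edges G \<equiv> snd G"

definition simple_graph :: "'a graph \<Rightarrow> bool" where
  "simple_graph G \<longleftrightarrow> finite (verts G) \<and> (\<forall>e\<in>edges G. e \<subseteq> verts G \<and> card e = 2)"

definition induced :: "'a graph \<Rightarrow> 'a set \<Rightarrow> 'a graph" where
  "induced G S = (S, {e \<in> edges G. e \<subseteq> S})"

definition graph_iso :: "'a graph \<Rightarrow> 'b graph \<Rightarrow> bool" where
  "graph_iso G H \<longleftrightarrow> (\<exists>f. bij_betw f (verts G) (verts H) \<and>
     (\<forall>u\<in>verts G. \<forall>v\<in>verts G. {u, v} \<in> edges G \<longleftrightarrow> {f u, f v} \<in> edges H))"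

definition induced_copies :: "'a graph \<Rightarrow> 'b graph \<Rightarrow> nat" where
  "induced_copies G H = card {S. S \<subseteq> verts G \<and> graph_iso (induced G S) H}"

text \<open>The host graphs range over all finite simple graphs with vertices of type \<^typ>\<open>nat\<close>;
  every finite graph is isomorphic to one of these. The maximum is attained whenever \<open>H\<close> has
  no isolated vertices (for paths, see \<open>finite_induced_copies_path\<close> below).\<close>

definition rho :: "'b graph \<Rightarrow> nat \<Rightarrow> nat" where
  "rho H m = Max {induced_copies G H | G :: nat graph. simple_graph G \<and> card (edges G) = m}"

definition path_graph :: "nat \<Rightarrow> nat graph" where
  "path_graph k = ({..<k}, {{i, Suc i} | i. Suc i < k})"

lemma simple_graph_path: "simple_graph (path_graph k)"
  unfolding simple_graph_def path_graph_def by auto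

lemma simple_graph_iso_nat:
  assumes "simple_graph (G :: 'a graph)"
  shows "\<exists>G' :: nat graph. simple_graph G' \<and> card (edges G') = card (edges G) \<and> graph_iso G G'"
proof -
  from assms have fin: "finite (verts G)" by (simp add: simple_graph_def)
  then obtain f :: "'a \<Rightarrow> nat" where inj: "inj_on f (verts G)"
    using finite_imp_inj_to_nat_seg by blast
  define G' where "G' = (f ` verts G, (\<lambda>e. f ` e) ` edges G)"
  have sub: "edges G \<subseteq> Pow (verts G)"
    using assms by (auto simp: simple_graph_def)
  have injE: "inj_on (\<lambda>e. f ` e) (edges G)"
    using inj_on_image_Pow[OF inj] sub by (rule inj_on_subset)
  have "simple_graph G'"
    using assms inj unfolding simple_graph_def G'_def
    by (auto simp: card_image inj_on_subset)
  moreover have "card (edges G') = card (edges G)"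
    using injE by (simp add: G'_def card_image)
  moreover have "{u, v} \<in> edges G \<longleftrightarrow> {f u, f v} \<in> edges G'"
    if "u \<in> verts G" "v \<in> verts G" for u v
  proof
    assume "{u, v} \<in> edges G"
    then have "f ` {u, v} \<in> edges G'" unfolding G'_def snd_conv by (rule imageI)
    then show "{f u, f v} \<in> edges G'" by simp
  next
    assume "{f u, f v} \<in> edges G'"
    then have "f ` {u, v} \<in> (\<lambda>e. f ` e) ` edges G" by (simp add: G'_def)
    then obtain e where e: "e \<in> edges G" "f ` {u, v} = f ` e" by (rule imageE)
    have "{u, v} \<subseteq> verts G" "e \<subseteq> verts G" using that e(1) sub by auto
    with e(2) have "{u, v} = e" by (simp only: inj_on_image_eq_iff[OF inj])
    with e show "{u, v} \<in> edges G" by simp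
  qed
  ultimately show ?thesis
    unfolding graph_iso_def using inj
    by (intro exI[of _ G'] conjI exI[of _ f]) (auto simp: G'_def bij_betw_def)
qed

lemma finite_induced_copies_path:
  assumes "k \<ge> 2"
  shows "finite {induced_copies G (path_graph k) | G :: nat graph.
    simple_graph G \<and> card (edges G) = m}"
proof -
  have "induced_copies G (path_graph k) \<le> 2 ^ (2 * m)"
    if G: "simple_graph G" "card (edges G) = m" for G :: "nat graph"
  proof -
    have finV: "finite (verts G)" and E: "\<And>e. e \<in> edges G \<Longrightarrow> e \<subseteq> verts G \<and> card e = 2"
      using G by (auto simp: simple_graph_def)
    have finE: "finite (edges G)"
      using E by (intro finite_subset[of "edges G" "Pow (verts G)"]) (auto simp: finV)
    have sub: "{S. S \<subseteq> verts G \<and> graph_iso (induced G S) (path_graph k)} \<subseteq> Pow (\<Union> (edges G))"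
    proof clarify
      fix S x assume S: "graph_iso (induced G S) (path_graph k)" and x: "x \<in> S"
      then obtain f where f: "bij_betw f S {..<k}"
        and iso: "\<And>u v. u \<in> S \<Longrightarrow> v \<in> S \<Longrightarrow>
          {u, v} \<in> edges (induced G S) \<longleftrightarrow> {f u, f v} \<in> edges (path_graph k)"
        by (auto simp: graph_iso_def induced_def path_graph_def)
      have fx: "f x < k" using f x by (auto simp: bij_betw_def)
      obtain j where j: "j < k" "{f x, j} \<in> edges (path_graph k)"
      proof (cases "f x")
        case 0
        show ?thesis
        proof (rule that)
          show "Suc 0 < k" using assms by simp
          then show "{f x, Suc 0} \<in> edges (path_graph k)"
            unfolding path_graph_def snd_conv 0 by blast
        qed
      next
        case (Suc i)
        show ?thesis
        proof (rule that)
          show "i < k" using fx Suc by simp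
          have "{f x, i} = {i, Suc i}" using Suc by auto
          moreover have "Suc i < k" using fx Suc by simp
          ultimately show "{f x, i} \<in> edges (path_graph k)"
            unfolding path_graph_def snd_conv by blast
        qed
      qed
      obtain y where "y \<in> S" "f y = j"
        using f j(1) by (metis bij_betw_imp_surj_on imageE lessThan_iff)
      with iso[OF x] j have "{x, y} \<in> edges (induced G S)" by auto
      then show "x \<in> \<Union> (edges G)" by (auto simp: induced_def)
    qed
    have finU: "finite (\<Union> (edges G))"
      using E finV by (intro finite_subset[of "\<Union> (edges G)" "verts G"]) auto
    have "card (\<Union> (edges G)) \<le> (\<Sum>e\<in>edges G. card e)"
      using card_Union_le_sum_card by blast
    also have "\<dots> = 2 * m" using E G by simp
    finally have "card (\<Union> (edges G)) \<le> 2 * m" .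
    then have "card (Pow (\<Union> (edges G))) \<le> 2 ^ (2 * m)"
      using finU by (simp only: card_Pow) (rule power_increasing, auto)
    moreover have "induced_copies G (path_graph k) \<le> card (Pow (\<Union> (edges G)))"
      unfolding induced_copies_def using sub finU by (intro card_mono) auto
    ultimately show ?thesis by linarith
  qed
  then show ?thesis
    by (intro finite_subset[OF _ finite_atMost[of "2 ^ (2 * m)"]]) auto
qed

end

(* Upper bound: let e_1, ..., e_2l be the edges of an induced path on 2l+1 vertices. Each of its two
   subpaths on 2l vertices, read in either direction, gives a sequence of l+1 edges: the perfect
   matching of the subpath in order, followed by the edge left over at an end of the path, for
   instance e_1, e_3, ..., e_(2l-1), e_2l. For l >= 2 these four sequences are different, since
   they start with e_1, e_2, e_(2l-1), e_2l. Now build such sequences edge by edge. There are m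
   choices for the first edge, and along each branch the sets of candidates for the l later edges
   are pairwise disjoint, so by AM-GM there are at most m * (m/l)^l sequences, hence at most a
   quarter as many induced paths.

   Lower bound: in a path on 2l+1 vertices keep every second vertex single and blow up the others,
   the two ends to size 2n and the inner ones to size n. This has (2l+2)n edges and at least
   4n^(l+1) induced paths. Enlarging one end class absorbs the remainder of m modulo 2l+2. *)

theory Submission
  imports Defs "HOL-Library.FuncSet"
begin

section \<open>AM-GM and a bound on the number of lists\<close>

text \<open>Convexity: \<open>x ^ Suc k\<close> lies above its tangent at \<open>y\<close>. In the
  induction the gap for \<open>Suc k\<close> is \<open>a\<close> times the gap for \<open>k\<close>
  plus a nonnegative multiple of the square of \<open>a - y\<close>.\<close>

lemma power_tangent_le:
  fixes a y :: real
  assumes "a \<ge> 0" "y \<ge> 0"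
  shows "real (Suc k) * a * y ^ k \<le> a ^ Suc k + real k * y ^ Suc k"
proof (induction k)
  case (Suc k)
  have "0 \<le> a * (a ^ Suc k + real k * y ^ Suc k - real (Suc k) * a * y ^ k)
      + real (Suc k) * y ^ k * (a - y)\<^sup>2"
    using Suc assms by (intro add_nonneg_nonneg mult_nonneg_nonneg) auto
  also have "\<dots> = a ^ Suc (Suc k) + real (Suc k) * y ^ Suc (Suc k)
      - real (Suc (Suc k)) * a * y ^ Suc k"
    by (simp add: algebra_simps power2_eq_square)
  finally show ?case by linarith
qed simp

text \<open>AM-GM for \<open>b\<close> and \<open>k\<close> equal parts of \<open>M - b\<close>:
  with \<open>a\<close> the mean and \<open>y\<close> one part, \<open>b = (k + 1) a - k y\<close>,
  which turns the claim into the tangent inequality.\<close>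

lemma mult_power_le_mean_power:
  fixes b M :: real
  assumes "0 \<le> b" "b \<le> M"
  shows "b * ((M - b) / real k) ^ k \<le> (M / real (Suc k)) ^ Suc k"
proof (cases "k = 0")
  case False
  define y where "y = (M - b) / real k"
  define a where "a = M / real (Suc k)"
  have "y \<ge> 0" "a \<ge> 0" using assms by (auto simp: y_def a_def)
  then have "real (Suc k) * a * y ^ k \<le> a ^ Suc k + real k * y ^ Suc k"
    by (intro power_tangent_le)
  moreover have "b = real (Suc k) * a - real k * y"
    using False by (simp add: a_def y_def del: of_nat_Suc)
  ultimately show ?thesis
    unfolding y_def[symmetric] a_def[symmetric]
    by (simp add: left_diff_distrib mult.assoc)
qed (use assms in simp)

text \<open>View \<open>T\<close> as the leaves of a tree of depth \<open>k\<close>. The hypothesis says that along each branch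
  the sets of possible next entries are pairwise disjoint, so their sizes add up to at most
  \<open>card E\<close>.\<close>

lemma card_lists_le_mean_power:
  fixes T :: "'a list set"
  assumes "finite E" "\<And>t. t \<in> T \<Longrightarrow> length t = k \<and> set t \<subseteq> E"
    and "\<And>s t i j. \<lbrakk>s \<in> T; t \<in> T; i < j; j < k; take i s = take i t\<rbrakk> \<Longrightarrow> s ! i \<noteq> t ! j"
  shows "real (card T) \<le> (real (card E) / real k) ^ k"
  using assms
proof (induction k arbitrary: T E)
  case 0
  then have "T \<subseteq> {[]}" by auto
  then have "card T \<le> card {[] :: 'a list}" by (intro card_mono) auto
  then show ?case by simp
next
  case (Suc k)
  define B where "B = hd ` T"
  define F where "F e = {t. e # t \<in> T}" for e
  have hdT: "\<exists>t'. t = hd t # t'" if "t \<in> T" for t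
    using Suc.prems(2)[OF that] by (cases t) auto
  have BE: "B \<subseteq> E"
  proof
    fix e assume "e \<in> B"
    then obtain t where t: "t \<in> T" "e = hd t" by (auto simp: B_def)
    then have "t \<noteq> []" "set t \<subseteq> E" using Suc.prems(2)[OF t(1)] by auto
    then show "e \<in> E" using t(2) by auto
  qed
  then have finB: "finite B" using Suc.prems(1) by (rule finite_subset)
  have T_eq: "T = (\<Union>e\<in>B. (#) e ` F e)"
    using hdT by (fastforce simp: B_def F_def)
  \<comment> \<open>By the disjointness hypothesis with \<open>i = 0\<close>, where the prefixes are
    empty, a first entry of a list in \<open>T\<close> never occurs later in any list of
    \<open>T\<close>. So all tails are lists over \<open>E - B\<close>.\<close>
  have F_le: "real (card (F e)) \<le> (real (card (E - B)) / real k) ^ k" for e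
  proof (rule Suc.IH)
    show "finite (E - B)" using Suc.prems(1) by simp
    show "length t = k \<and> set t \<subseteq> E - B" if "t \<in> F e" for t
    proof -
      have et: "e # t \<in> T" using that by (simp add: F_def)
      then have len: "length t = k" and sub: "set t \<subseteq> E" using Suc.prems(2) by fastforce+
      have "t ! j \<noteq> hd s" if "s \<in> T" "j < k" for s j
      proof -
        have "s ! 0 \<noteq> (e # t) ! Suc j"
          using Suc.prems(3)[OF \<open>s \<in> T\<close> et, of 0 "Suc j"] that by simp
        then show ?thesis using hdT[OF \<open>s \<in> T\<close>] by (metis nth_Cons_0 nth_Cons_Suc)
      qed
      then have "set t \<inter> B = {}"
        using len by (auto simp: B_def in_set_conv_nth)
      then show ?thesis using len sub by auto
    qed
    show "s ! i \<noteq> t ! j"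
      if "s \<in> F e" "t \<in> F e" "i < j" "j < k" "take i s = take i t" for s t i j
      using Suc.prems(3)[of "e # s" "e # t" "Suc i" "Suc j"] that by (simp add: F_def)
  qed
  have "card T \<le> (\<Sum>e\<in>B. card ((#) e ` F e))"
    unfolding T_eq using finB by (rule card_UN_le)
  also have "\<dots> = (\<Sum>e\<in>B. card (F e))"
    by (simp add: card_image)
  finally have "real (card T) \<le> (\<Sum>e\<in>B. real (card (F e)))"
    by (metis of_nat_le_iff of_nat_sum)
  also have "\<dots> \<le> real (card B) * (real (card (E - B)) / real k) ^ k"
    using sum_bounded_above[OF F_le, where A = B] by simp
  also have "\<dots> = real (card B) * ((real (card E) - real (card B)) / real k) ^ k"
    using BE finB Suc.prems(1) by (simp add: card_Diff_subset of_nat_diff card_mono)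
  also have "\<dots> \<le> (real (card E) / real (Suc k)) ^ Suc k"
    using BE Suc.prems(1) by (intro mult_power_le_mean_power) (auto intro: card_mono)
  finally show ?case .
qed

section \<open>Induced paths as vertex sequences\<close>

text \<open>A copy together with a direction of traversal, on which the codes below depend. The
  values of \<open>p\<close> from \<open>k\<close> on are unrestricted.\<close>

definition induced_path :: "'a graph \<Rightarrow> nat \<Rightarrow> (nat \<Rightarrow> 'a) \<Rightarrow> bool" where
  "induced_path G k p \<longleftrightarrow> inj_on p {..<k} \<and> p ` {..<k} \<subseteq> verts G \<and>
     (\<forall>i<k. \<forall>j<k. {p i, p j} \<in> edges G \<longleftrightarrow> j = Suc i \<or> i = Suc j)"

lemma edges_path_graph_iff:
  assumes "i < k" "j < k"
  shows "{i, j} \<in> edges (path_graph k) \<longleftrightarrow> j = Suc i \<or> i = Suc j"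
  using assms by (auto simp: path_graph_def doubleton_eq_iff)

lemma induced_pathD:
  assumes "induced_path G k p"
  shows "i < k \<Longrightarrow> j < k \<Longrightarrow> {p i, p j} \<in> edges G \<longleftrightarrow> j = Suc i \<or> i = Suc j"
    and "i < k \<Longrightarrow> j < k \<Longrightarrow> p i = p j \<longleftrightarrow> i = j"
  using assms by (auto simp: induced_path_def inj_on_eq_iff)

lemma graph_iso_path_iff:
  assumes "S \<subseteq> verts G"
  shows "graph_iso (induced G S) (path_graph k) \<longleftrightarrow>
    (\<exists>p. induced_path G k p \<and> p ` {..<k} = S)"
proof
  assume "graph_iso (induced G S) (path_graph k)"
  then obtain f where f: "bij_betw f S {..<k}"
    and iso: "\<And>u v. u \<in> S \<Longrightarrow> v \<in> S \<Longrightarrow> {u, v} \<in> edges G \<longleftrightarrow> {f u, f v} \<in> edges (path_graph k)"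
    by (auto simp: graph_iso_def induced_def path_graph_def)
  define p where "p = inv_into S f"
  have p: "bij_betw p {..<k} S" unfolding p_def by (rule bij_betw_inv_into[OF f])
  then have pS: "p i \<in> S" if "i < k" for i using that by (auto simp: bij_betw_def)
  have fp: "f (p i) = i" if "i < k" for i
    unfolding p_def using f that by (simp add: bij_betw_inv_into_right)
  have "{p i, p j} \<in> edges G \<longleftrightarrow> j = Suc i \<or> i = Suc j" if "i < k" "j < k" for i j
    using iso[OF pS pS, OF that] fp that by (simp add: edges_path_graph_iff)
  then have "induced_path G k p"
    using p assms unfolding induced_path_def by (auto simp: bij_betw_def)
  with p show "\<exists>p. induced_path G k p \<and> p ` {..<k} = S" by (auto simp: bij_betw_def)
next
  assume "\<exists>p. induced_path G k p \<and> p ` {..<k} = S"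
  then obtain p where p: "induced_path G k p" and S: "p ` {..<k} = S" by blast
  define f where "f = inv_into {..<k} p"
  have pb: "bij_betw p {..<k} S" using p S by (auto simp: induced_path_def bij_betw_def)
  then have fb: "bij_betw f S {..<k}" unfolding f_def by (rule bij_betw_inv_into)
  have pf: "p (f u) = u" "f u < k" if "u \<in> S" for u
    using that pb fb bij_betw_inv_into_right[OF pb] by (auto simp: f_def bij_betw_def)
  have "{u, v} \<in> edges G \<longleftrightarrow> {f u, f v} \<in> edges (path_graph k)" if "u \<in> S" "v \<in> S" for u v
    using induced_pathD(1)[OF p pf(2) pf(2), OF that] pf that by (simp add: edges_path_graph_iff)
  then show "graph_iso (induced G S) (path_graph k)"
    unfolding graph_iso_def using fb
    by (intro exI[of _ f]) (auto simp: induced_def path_graph_def)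
qed

lemma induced_path_rev:
  assumes "induced_path G (Suc k) p"
  shows "induced_path G (Suc k) (\<lambda>i. p (k - i))"
proof -
  have "inj_on (\<lambda>i. p (k - i)) {..<Suc k}"
    by (auto simp: inj_on_def induced_pathD(2)[OF assms])
  moreover have "{p (k - i), p (k - j)} \<in> edges G \<longleftrightarrow> j = Suc i \<or> i = Suc j"
    if "i < Suc k" "j < Suc k" for i j
    using induced_pathD(1)[OF assms, of "k - i" "k - j"] that by auto
  ultimately show ?thesis
    using assms unfolding induced_path_def by auto
qed

lemma image_rev_lessThan: "(\<lambda>i. p (k - i)) ` {..<Suc k} = p ` {..<Suc k}"
proof -
  have "(\<lambda>i. k - i) ` {..<Suc k} = {..<Suc k}"
    by (intro bij_betw_imp_surj_on bij_betw_byWitness[where f' = "\<lambda>i. k - i"]) auto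
  then show ?thesis by (metis image_image)
qed

section \<open>The upper bound\<close>

definition matching_list :: "nat \<Rightarrow> (nat \<Rightarrow> 'a) \<Rightarrow> 'a set list" where
  "matching_list l q = map (\<lambda>i. {q (2 * i), q (2 * i + 1)}) [0..<l]"

text \<open>The condition on the last edge \<open>e\<close> keeps only what the disjointness
  argument uses: \<open>e\<close> meets the start \<open>q 0\<close>, or it leaves the far end
  towards a vertex \<open>w\<close> that is not adjacent to the earlier vertices.\<close>

definition path_codes :: "'a graph \<Rightarrow> nat \<Rightarrow> 'a set list set" where
  "path_codes G l = {matching_list l q @ [e] | q e. induced_path G (2 * l) q \<and> e \<in> edges G \<and>
     (q 0 \<in> e \<or> (\<exists>w. e = {q (2 * l - 1), w} \<and> (\<forall>i<2 * l - 1. {w, q i} \<notin> edges G)))}"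

text \<open>A test that tells the next matching edge from all later entries. It depends on the
  earlier entries only through their union \<open>Q\<close>, so it is the same test for all codes
  sharing a prefix.\<close>

definition attached :: "'a graph \<Rightarrow> 'a set \<Rightarrow> 'a set \<Rightarrow> bool" where
  "attached G Q e \<longleftrightarrow> e \<inter> Q = {} \<and> (\<exists>u\<in>e. \<exists>v\<in>Q. {u, v} \<in> edges G)"

lemma length_path_codes: "t \<in> path_codes G l \<Longrightarrow> length t = Suc l"
  by (auto simp: path_codes_def matching_list_def)

lemma set_path_codes: "t \<in> path_codes G l \<Longrightarrow> set t \<subseteq> edges G"
  by (auto simp: path_codes_def matching_list_def induced_pathD(1))

lemma Union_matching_list: "\<Union> (set (matching_list l q)) = q ` {..<2 * l}"
proof (induction l)
  case (Suc l)
  have "{..<2 * Suc l} = {..<2 * l} \<union> {2 * l, 2 * l + 1}" by auto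
  then show ?case using Suc by (auto simp: matching_list_def)
qed (simp add: matching_list_def)

text \<open>Each entry but the first and the last is joined to the union of the earlier entries;
  the later ones either meet this union (if the last edge goes back to the start) or are not
  joined to it.\<close>

lemma attached_path_codes:
  assumes "t \<in> path_codes G l" "0 < i" "i < l"
  shows "attached G (\<Union> (set (take i t))) (t ! i)"
    and "i < j \<Longrightarrow> j \<le> l \<Longrightarrow> \<not> attached G (\<Union> (set (take i t))) (t ! j)"
proof -
  obtain q e where t: "t = matching_list l q @ [e]" and q: "induced_path G (2 * l) q"
    and e: "q 0 \<in> e \<or> (\<exists>w. e = {q (2 * l - 1), w} \<and> (\<forall>i<2 * l - 1. {w, q i} \<notin> edges G))"
    using assms(1) by (auto simp: path_codes_def)
  have "take i t = matching_list i q"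
    using assms(3) by (simp add: t matching_list_def take_map)
  then have Q: "\<Union> (set (take i t)) = q ` {..<2 * i}"
    by (simp add: Union_matching_list)
  have nth: "t ! j = {q (2 * j), q (2 * j + 1)}" if "j < l" for j
    using that by (simp add: t matching_list_def nth_append)
  have "q (2 * i) \<notin> q ` {..<2 * i}" "q (2 * i + 1) \<notin> q ` {..<2 * i}"
    using assms(3) by (auto simp: induced_pathD(2)[OF q])
  \<comment> \<open>The path edge between two consecutive matching edges joins entry
    \<open>i\<close> to the prefix.\<close>
  moreover have "{q (2 * i), q (2 * i - 1)} \<in> edges G"
    using assms(2,3) by (subst induced_pathD(1)[OF q]) auto
  moreover have "2 * i - 1 < 2 * i" using assms(2) by simp
  ultimately show "attached G (\<Union> (set (take i t))) (t ! i)"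
    unfolding attached_def Q nth[OF assms(3)] by blast
  show "\<not> attached G (\<Union> (set (take i t))) (t ! j)" if j: "i < j" "j \<le> l"
  proof (cases "j = l")
    case False
    \<comment> \<open>Indices in the prefix are at most \<open>2 * i - 1\<close>, those in entry
      \<open>j\<close> at least \<open>2 * i + 2\<close>.\<close>
    then show ?thesis
      unfolding attached_def Q using j by (auto simp: nth induced_pathD(1)[OF q])
  next
    case True
    have tj: "t ! j = e" by (simp add: True t matching_list_def nth_append)
    show ?thesis
    proof (cases "q 0 \<in> e")
      case True
      then show ?thesis unfolding attached_def Q tj using assms(2) by auto
    next
      case False
      then obtain w where "e = {q (2 * l - 1), w}" "\<forall>i<2 * l - 1. {w, q i} \<notin> edges G"
        using e by blast
      \<comment> \<open>The only path neighbour of \<open>q (2 * l - 1)\<close> is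
        \<open>q (2 * l - 2)\<close>, which is outside the prefix because
        \<open>i < l\<close>.\<close>
      then show ?thesis
        unfolding attached_def Q tj using assms(2,3) by (auto simp: induced_pathD(1)[OF q])
    qed
  qed
qed

lemma finite_edges: "simple_graph G \<Longrightarrow> finite (edges G)"
  by (rule finite_subset[of _ "Pow (verts G)"]) (auto simp: simple_graph_def)

lemma finite_path_codes: "simple_graph G \<Longrightarrow> finite (path_codes G l)"
  by (rule finite_subset[OF _ finite_lists_length_eq[OF finite_edges, of G "Suc l"]])
    (use length_path_codes set_path_codes in blast)

text \<open>The first edge is chosen freely, in \<open>m\<close> ways. The remaining
  \<open>l\<close> entries satisfy the hypothesis of \<open>card_lists_le_mean_power\<close>, with
  \<open>attached\<close> separating the candidates.\<close>

lemma card_path_codes_le: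
  assumes "simple_graph G" "card (edges G) = m"
  shows "real (card (path_codes G l)) \<le> real m * (real m / real l) ^ l"
proof -
  define F where "F e = {t. e # t \<in> path_codes G l}" for e
  note fin = finite_edges[OF assms(1)]
  have F_le: "real (card (F e)) \<le> (real m / real l) ^ l" for e
    unfolding assms(2)[symmetric]
  proof (rule card_lists_le_mean_power)
    show "length t = l \<and> set t \<subseteq> edges G" if "t \<in> F e" for t
      using that length_path_codes[of "e # t" G l] set_path_codes[of "e # t" G l]
      by (simp add: F_def)
    show "s ! i \<noteq> t ! j"
      if "s \<in> F e" "t \<in> F e" "i < j" "j < l" "take i s = take i t" for s t i j
    proof -
      \<comment> \<open>Restoring \<open>e\<close> shifts positions by one: \<open>Suc i\<close> is
        positive and, as \<open>i < j < l\<close>, still below \<open>l\<close>, while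
        \<open>Suc j\<close> may be the last position \<open>l\<close>.\<close>
      let ?Q = "\<Union> (set (take (Suc i) (e # s)))"
      have "attached G ?Q ((e # s) ! Suc i)"
        using that by (intro attached_path_codes) (auto simp: F_def)
      moreover have "\<not> attached G (\<Union> (set (take (Suc i) (e # t)))) ((e # t) ! Suc j)"
        using that by (intro attached_path_codes) (auto simp: F_def)
      ultimately show ?thesis using that by auto
    qed
  qed (rule fin)
  have "path_codes G l \<subseteq> (\<Union>e\<in>edges G. (#) e ` F e)"
  proof
    fix t assume t: "t \<in> path_codes G l"
    then obtain e t' where "t = e # t'" using length_path_codes by (cases t) fastforce+
    then show "t \<in> (\<Union>e\<in>edges G. (#) e ` F e)"
      using t set_path_codes[OF t] by (auto simp: F_def)
  qed
  moreover have finF: "finite (F e)" for e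
    using finite_vimageI[OF finite_path_codes[OF assms(1)], of "(#) e" l]
    by (simp add: F_def vimage_def)
  ultimately have "card (path_codes G l) \<le> card (\<Union>e\<in>edges G. (#) e ` F e)"
    using fin by (intro card_mono) auto
  also have "\<dots> \<le> (\<Sum>e\<in>edges G. card ((#) e ` F e))"
    using fin by (rule card_UN_le)
  also have "\<dots> = (\<Sum>e\<in>edges G. card (F e))"
    by (simp add: card_image)
  finally have "real (card (path_codes G l)) \<le> (\<Sum>e\<in>edges G. real (card (F e)))"
    by (metis of_nat_le_iff of_nat_sum)
  also have "\<dots> \<le> real m * (real m / real l) ^ l"
    using sum_bounded_above[OF F_le, where A = "edges G"] assms(2) by simp
  finally show ?thesis .
qed

text \<open>Dropping the last vertex leaves an edge at the far end, with
  \<open>w = p (2 * l)\<close>. Dropping the first leaves an edge through \<open>p 1\<close>, the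
  start of the shifted path.\<close>

lemma path_codes_of_path:
  assumes p: "induced_path G (2 * l + 1) p" and l: "l \<ge> 1"
  shows "matching_list l p @ [{p (2 * l - 1), p (2 * l)}] \<in> path_codes G l" (is ?A)
    and "matching_list l (\<lambda>i. p (Suc i)) @ [{p 0, p 1}] \<in> path_codes G l" (is ?B)
proof -
  have 1: "induced_path G (2 * l) p" "induced_path G (2 * l) (\<lambda>i. p (Suc i))"
    using p by (auto simp: induced_path_def inj_on_def)
  have 2: "{p (2 * l - 1), p (2 * l)} \<in> edges G" "{p 0, p 1} \<in> edges G"
    using l by (auto simp: induced_pathD(1)[OF p])
  have "\<forall>i<2 * l - 1. {p (2 * l), p i} \<notin> edges G"
    by (auto simp: induced_pathD(1)[OF p])
  with 1 2 show ?A unfolding path_codes_def by blast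
  show ?B unfolding path_codes_def using 1 2 by fastforce
qed

text \<open>The codes come from \<open>p\<close> and its reversal \<open>r\<close>. Restricting to
  codes with a given union ensures that different copies do not share codes.\<close>

lemma four_path_codes:
  assumes p: "induced_path G (2 * l + 1) p" and l: "l \<ge> 2" and "simple_graph G"
  shows "4 \<le> card {t \<in> path_codes G l. \<Union> (set t) = p ` {..<2 * l + 1}}"
proof -
  define r where "r i = p (2 * l - i)" for i
  define A where "A p = matching_list l p @ [{p (2 * l - 1), p (2 * l)}]" for p :: "nat \<Rightarrow> 'a"
  define B where "B p = matching_list l (\<lambda>i. p (Suc i)) @ [{p 0, p 1}]" for p :: "nat \<Rightarrow> 'a"
  have r: "induced_path G (2 * l + 1) r"
    using induced_path_rev[of G "2 * l" p] p by (simp add: r_def[abs_def])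
  have img: "r ` {..<2 * l + 1} = p ` {..<2 * l + 1}"
    using image_rev_lessThan[of p "2 * l"] by (simp add: r_def[abs_def])
  have UA: "\<Union> (set (A p)) = p ` {..<2 * l + 1}" for p :: "nat \<Rightarrow> 'a"
  proof -
    have "{..<2 * l + 1} = {..<2 * l} \<union> {2 * l - 1, 2 * l}" using l by auto
    then show ?thesis by (auto simp: A_def Union_matching_list)
  qed
  have UB: "\<Union> (set (B p)) = p ` {..<2 * l + 1}" for p :: "nat \<Rightarrow> 'a"
  proof -
    have "{..<2 * l + 1} = Suc ` {..<2 * l} \<union> {0, 1}"
      using l by (simp add: image_Suc_lessThan) auto
    then show ?thesis by (auto simp: B_def Union_matching_list image_image)
  qed
  have hds: "hd (A p) = {p 0, p 1}" "hd (B p) = {p 1, p 2}" for p :: "nat \<Rightarrow> 'a"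
    using l by (auto simp: A_def B_def matching_list_def hd_append hd_map numeral_2_eq_2)
  \<comment> \<open>\<open>p 1\<close> lies in both heads coming from \<open>p\<close> and, since
    \<open>2 * l - 2 > 1\<close>, in neither coming from \<open>r\<close>. Within each pair,
    \<open>p 0\<close> or \<open>r 0\<close> tells the heads apart.\<close>
  have "p 0 \<notin> {p 1, p 2}" "r 0 \<notin> {r 1, r 2}" "p 1 \<notin> {r 0, r 1, r 2}"
    using l by (auto simp: r_def induced_pathD(2)[OF p])
  then have "distinct (map hd [A p, B p, A r, B r])"
    unfolding hds list.map by auto
  then have "distinct [A p, B p, A r, B r]" by (simp only: distinct_map)
  then have card: "card {A p, B p, A r, B r} = 4"
    using distinct_card[of "[A p, B p, A r, B r]"] by simp
  have "{A p, B p, A r, B r} \<subseteq> {t \<in> path_codes G l. \<Union> (set t) = p ` {..<2 * l + 1}}"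
  proof -
    have "A p \<in> path_codes G l" "B p \<in> path_codes G l"
      "A r \<in> path_codes G l" "B r \<in> path_codes G l"
      unfolding A_def B_def using l by (intro path_codes_of_path p r; simp)+
    then show ?thesis
      by (simp only: insert_subset mem_Collect_eq UA UB img) simp
  qed
  moreover have "finite {t \<in> path_codes G l. \<Union> (set t) = p ` {..<2 * l + 1}}"
    using finite_path_codes[OF assms(3)] by simp
  ultimately show ?thesis unfolding card[symmetric] by (intro card_mono)
qed

text \<open>Double counting: each copy \<open>S\<close> has at least four codes with union
  \<open>S\<close>, and these families are disjoint subsets of
  \<open>path_codes G l\<close>.\<close>

lemma induced_copies_path_le:
  assumes "simple_graph G" "card (edges G) = m" "l \<ge> 2"
  shows "real (induced_copies G (path_graph (2 * l + 1))) \<le> real m ^ (l + 1) / (4 * real l ^ l)"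
proof -
  define C where "C = {S. S \<subseteq> verts G \<and> graph_iso (induced G S) (path_graph (2 * l + 1))}"
  define F where "F S = {t \<in> path_codes G l. \<Union> (set t) = S}" for S
  have "finite (verts G)" using assms(1) by (simp add: simple_graph_def)
  then have finC: "finite C" by (simp add: C_def)
  have finF: "finite (F S)" for S
    using finite_path_codes[OF assms(1)] by (simp add: F_def)
  have "4 \<le> card (F S)" if "S \<in> C" for S
    using that four_path_codes[OF _ assms(3,1)] graph_iso_path_iff[of S G "2 * l + 1"]
    by (auto simp: C_def F_def)
  then have "4 * card C \<le> (\<Sum>S\<in>C. card (F S))"
    using sum_bounded_below[of C 4 "\<lambda>S. card (F S)"] by simp
  also have "\<dots> = card (\<Union>S\<in>C. F S)"
    using finC finF by (intro card_UN_disjoint[symmetric]) (auto simp: F_def)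
  also have "\<dots> \<le> card (path_codes G l)"
    using finite_path_codes[OF assms(1)] by (intro card_mono) (auto simp: F_def)
  finally have "real (4 * card C) \<le> real (card (path_codes G l))"
    by (rule of_nat_mono)
  also have "\<dots> \<le> real m * (real m / real l) ^ l"
    by (rule card_path_codes_le[OF assms(1,2)])
  finally show ?thesis
    unfolding induced_copies_def C_def[symmetric] using assms(3)
    by (simp add: field_simps power_divide)
qed

section \<open>The lower bound\<close>

text \<open>An isomorphism \<open>f\<close> sends an induced path \<open>p\<close> to
  \<open>f \<circ> p\<close>, and taking images under \<open>f\<close> is injective on subsets of
  \<open>verts G\<close>.\<close>

lemma induced_copies_path_mono:
  assumes "graph_iso G G'" "finite (verts G')"
  shows "induced_copies G (path_graph k) \<le> induced_copies G' (path_graph k)"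
proof -
  obtain f where f: "bij_betw f (verts G) (verts G')"
    and iso: "\<And>u v. u \<in> verts G \<Longrightarrow> v \<in> verts G \<Longrightarrow> {u, v} \<in> edges G \<longleftrightarrow> {f u, f v} \<in> edges G'"
    using assms(1) by (auto simp: graph_iso_def)
  have inj: "inj_on f (verts G)" and im: "f ` verts G = verts G'"
    using f by (auto simp: bij_betw_def)
  have "graph_iso (induced G' (f ` S)) (path_graph k)"
    if S: "S \<subseteq> verts G" "graph_iso (induced G S) (path_graph k)" for S
  proof -
    obtain p where p: "induced_path G k p" "p ` {..<k} = S"
      using S by (auto simp: graph_iso_path_iff)
    have pv: "p i \<in> verts G" if "i < k" for i using that p S by auto
    have "inj_on (f \<circ> p) {..<k}"
      using p S inj by (intro comp_inj_on) (auto simp: induced_path_def intro: inj_on_subset)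
    moreover have "(f \<circ> p) ` {..<k} \<subseteq> verts G'" using pv im by auto
    moreover have "{(f \<circ> p) i, (f \<circ> p) j} \<in> edges G' \<longleftrightarrow> j = Suc i \<or> i = Suc j"
      if "i < k" "j < k" for i j
      using iso[OF pv pv, OF that] induced_pathD(1)[OF p(1) that] by simp
    ultimately have "induced_path G' k (f \<circ> p)" by (simp add: induced_path_def)
    moreover have "(f \<circ> p) ` {..<k} = f ` S" using p(2) by (metis image_comp)
    moreover have "f ` S \<subseteq> verts G'" using S im by auto
    ultimately show ?thesis
      by (intro graph_iso_path_iff[THEN iffD2] exI[of _ "f \<circ> p"] conjI)
  qed
  then show ?thesis
    unfolding induced_copies_def using assms(2) im inj_on_image_Pow[OF inj]
    by (intro card_inj_on_le[where f = "(`) f"]) (auto intro: inj_on_subset)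
qed

lemma induced_copies_path_le_rho:
  assumes "simple_graph (G :: 'a graph)" "k \<ge> 2"
  shows "induced_copies G (path_graph k) \<le> rho (path_graph k) (card (edges G))"
proof -
  obtain G' :: "nat graph" where G': "simple_graph G'" "card (edges G') = card (edges G)"
    "graph_iso G G'"
    using simple_graph_iso_nat[OF assms(1)] by blast
  have "induced_copies G (path_graph k) \<le> induced_copies G' (path_graph k)"
    using G' by (intro induced_copies_path_mono) (auto simp: simple_graph_def)
  also have "\<dots> \<le> rho (path_graph k) (card (edges G))"
    unfolding rho_def using G' finite_induced_copies_path[OF assms(2)]
    by (intro Max_ge) blast+
  finally show ?thesis .
qed

section \<open>Blow-ups of a path\<close>

definition path_blowup :: "nat \<Rightarrow> (nat \<Rightarrow> nat) \<Rightarrow> (nat \<times> nat) graph" where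
  "path_blowup k N = ((SIGMA i:{..<k}. {..<N i}),
     {{(i, a), (Suc i, b)} | i a b. Suc i < k \<and> a < N i \<and> b < N (Suc i)})"

lemma simple_graph_path_blowup: "simple_graph (path_blowup k N)"
  by (auto simp: simple_graph_def path_blowup_def)

lemma card_edges_path_blowup:
  "card (edges (path_blowup (Suc k) N)) = (\<Sum>i<k. N i * N (Suc i))"
proof -
  have "edges (path_blowup (Suc k) N) = (\<lambda>(i, a, b). {(i, a), (Suc i, b)}) `
      (SIGMA i:{..<k}. {..<N i} \<times> {..<N (Suc i)})"
    by (force simp: path_blowup_def image_iff)
  moreover have "inj_on (\<lambda>(i, a, b). {(i, a), (Suc i, b)})
      (SIGMA i:{..<k}. {..<N i} \<times> {..<N (Suc i)})"
    by (auto simp: inj_on_def doubleton_eq_iff)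
  ultimately show ?thesis by (simp add: card_image)
qed

text \<open>Choosing one vertex from each class gives an induced path, and different choices give
  different vertex sets.\<close>

lemma induced_copies_path_blowup:
  "(\<Prod>i<k. N i) \<le> induced_copies (path_blowup k N) (path_graph k)"
proof -
  let ?G = "path_blowup k N"
  define \<Phi> where "\<Phi> = Pi\<^sub>E {..<k} (\<lambda>i. {..<N i})"
  define S where "S \<phi> = (\<lambda>i. (i, \<phi> i)) ` {..<k}" for \<phi> :: "nat \<Rightarrow> nat"
  have "inj_on S \<Phi>"
  proof (rule inj_onI)
    fix \<phi> \<psi> assume \<phi>: "\<phi> \<in> \<Phi>" "\<psi> \<in> \<Phi>" "S \<phi> = S \<psi>"
    then have "\<phi> i = \<psi> i" if "i < k" for i
      using that by (fastforce simp: S_def set_eq_iff image_iff)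
    with \<phi> show "\<phi> = \<psi>" unfolding \<Phi>_def by (intro PiE_ext) auto
  qed
  moreover have "S \<phi> \<subseteq> verts ?G \<and> graph_iso (induced ?G (S \<phi>)) (path_graph k)"
    if "\<phi> \<in> \<Phi>" for \<phi>
  proof -
    have \<phi>: "\<phi> i < N i" if "i < k" for i using that \<open>\<phi> \<in> \<Phi>\<close> by (auto simp: \<Phi>_def)
    then have sub: "S \<phi> \<subseteq> verts ?G" by (auto simp: S_def path_blowup_def)
    have "{(i, \<phi> i), (j, \<phi> j)} \<in> edges ?G \<longleftrightarrow> j = Suc i \<or> i = Suc j" if "i < k" "j < k" for i j
      using that \<phi> by (auto simp: path_blowup_def doubleton_eq_iff)
    then have "induced_path ?G k (\<lambda>i. (i, \<phi> i))"
      using sub by (auto simp: induced_path_def S_def inj_on_def)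
    with sub show ?thesis by (auto simp: graph_iso_path_iff S_def)
  qed
  ultimately have "card \<Phi> \<le> induced_copies ?G (path_graph k)"
    unfolding induced_copies_def
    by (intro card_inj_on_le[of S]) (auto simp: path_blowup_def)
  then show ?thesis by (simp add: \<Phi>_def card_PiE)
qed

lemma prod_lessThan_double_Suc:
  fixes f :: "nat \<Rightarrow> 'a :: comm_monoid_mult"
  shows "(\<Prod>i<2 * l + 1. f i) = (\<Prod>j<l. f (2 * j) * f (2 * j + 1)) * f (2 * l)"
  by (induction l) (simp_all add: mult_ac)

lemma sum_lessThan_double:
  fixes f :: "nat \<Rightarrow> 'a :: comm_monoid_add"
  shows "(\<Sum>i<2 * l. f i) = (\<Sum>j<l. f (2 * j) + f (2 * j + 1))"
  by (induction l) (simp_all add: add_ac)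

text \<open>The blow-up described at the top gives the bound. The second claim makes the set under
  \<open>Max\<close> in \<open>rho\<close> nonempty.\<close>

lemma rho_path_ge:
  assumes "l \<ge> 1"
  shows "4 * (m div (2 * l + 2)) ^ (l + 1) \<le> rho (path_graph (2 * l + 1)) m"
    and "\<exists>G :: nat graph. simple_graph G \<and> card (edges G) = m"
proof -
  define n where "n = m div (2 * l + 2)"
  define r where "r = m mod (2 * l + 2)"
  \<comment> \<open>The class sizes are \<open>2n + r, 1, n, 1, ..., n, 1, 2n\<close>. An inner
    class of size \<open>n\<close> meets two single vertices and an end class only one, so doubling
    the ends makes all even classes contribute \<open>2n\<close> edges, up to the remainder
    \<open>r\<close>.\<close>
  define N where "N i = (if odd i then 1 else
    n + (if i = 0 then n + r else 0) + (if i = 2 * l then n else 0))" for i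
  let ?G = "path_blowup (2 * l + 1) N"
  obtain k where k: "l = Suc k" using assms by (cases l) auto
  have "card (edges ?G) = (\<Sum>i<2 * l. N i * N (Suc i))"
    using card_edges_path_blowup[of "2 * l" N] by simp
  \<comment> \<open>Each pair of consecutive classes contains one single vertex, so it contributes
    the size of its even class; the two sums pair even classes with the next and the previous single
    vertex.\<close>
  also have "\<dots> = (\<Sum>j<l. N (2 * j)) + (\<Sum>j<l. N (2 * Suc j))"
    unfolding sum_lessThan_double sum.distrib by (simp add: N_def)
  also have "(\<Sum>j<l. N (2 * j)) = l * n + n + r"
    unfolding k sum.lessThan_Suc_shift by (simp add: N_def k)
  also have "(\<Sum>j<l. N (2 * Suc j)) = l * n + n"
    unfolding k sum.lessThan_Suc by (simp add: N_def k)
  also have "(l * n + n + r) + (l * n + n) = (2 * l + 2) * n + r"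
    by (simp add: algebra_simps)
  also have "\<dots> = m" unfolding n_def r_def by (rule mult_div_mod_eq)
  finally have m: "card (edges ?G) = m" .
  \<comment> \<open>The factor 4 comes from the two doubled ends; the \<open>k = l - 1\<close> inner
    even classes give \<open>n ^ k\<close>.\<close>
  have "4 * n ^ (l + 1) \<le> (2 * n + r) * n ^ k * (2 * n)"
    by (simp add: k algebra_simps)
  also have "\<dots> = (\<Prod>j<l. N (2 * j)) * N (2 * l)"
    unfolding k prod.lessThan_Suc_shift by (simp add: N_def k mult_2)
  also have "\<dots> = (\<Prod>i<2 * l + 1. N i)"
    unfolding prod_lessThan_double_Suc by (simp add: N_def)
  also have "\<dots> \<le> induced_copies ?G (path_graph (2 * l + 1))"
    by (rule induced_copies_path_blowup)
  also have "\<dots> \<le> rho (path_graph (2 * l + 1)) m"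
    unfolding m[symmetric] using assms
    by (intro induced_copies_path_le_rho simple_graph_path_blowup) simp
  finally show "4 * (m div (2 * l + 2)) ^ (l + 1) \<le> rho (path_graph (2 * l + 1)) m"
    unfolding n_def .
  show "\<exists>G :: nat graph. simple_graph G \<and> card (edges G) = m"
    using simple_graph_iso_nat[OF simple_graph_path_blowup] m by metis
qed

section \<open>Asymptotics of the lower bound\<close>

text \<open>Rounding \<open>m\<close> down to a multiple of \<open>c\<close> loses at most
  \<open>c\<close>, so the ratio lies between \<open>1 - c / m\<close> and 1.\<close>

lemma tendsto_div_mult_divide:
  assumes "c > 0"
  shows "(\<lambda>m. real (m div c) * real c / real m) \<longlonglongrightarrow> 1"
proof (rule tendsto_sandwich)
  show "\<forall>\<^sub>F m in sequentially. 1 - real c / real m \<le> real (m div c) * real c / real m"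
    using eventually_gt_at_top[of 0]
  proof eventually_elim
    case (elim m)
    have "m \<le> m div c * c + c" using assms
      by (metis div_mult_mod_eq add_left_mono less_imp_le_nat mod_less_divisor)
    then have "real m \<le> real (m div c) * real c + real c"
      by (metis of_nat_add of_nat_le_iff of_nat_mult)
    then have "real m - real c \<le> real (m div c) * real c" by simp
    then have "(real m - real c) / real m \<le> real (m div c) * real c / real m"
      by (rule divide_right_mono) simp
    with elim show ?case by (simp add: diff_divide_distrib)
  qed
  show "\<forall>\<^sub>F m in sequentially. real (m div c) * real c / real m \<le> 1"
    using eventually_gt_at_top[of 0]
  proof eventually_elim
    case (elim m)
    have "real (m div c) * real c \<le> real m"
      by (metis div_times_less_eq_dividend of_nat_le_iff of_nat_mult)
    with elim show ?case by simp
  qed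
  show "(\<lambda>m. 1 - real c / real m) \<longlonglongrightarrow> 1"
    using tendsto_diff[OF tendsto_const lim_const_over_n[of "real c"], of 1] by simp
qed simp

theorem theorem1p5:
  fixes l :: nat
  assumes "l \<ge> 2"
  shows "(\<exists>\<epsilon> :: nat \<Rightarrow> real. \<epsilon> \<longlonglongrightarrow> 0 \<and>
            (\<forall>m::nat. m \<ge> 1 \<longrightarrow>
              (1 + \<epsilon> m) * 4 * (real m ^ (l + 1) / (2 * real l + 2) ^ (l + 1))
                \<le> real (rho (path_graph (2 * l + 1)) m)))
       \<and> (\<forall>m::nat. m \<ge> 1 \<longrightarrow>
            real (rho (path_graph (2 * l + 1)) m) \<le> real m ^ (l + 1) / (4 * real l ^ l))"
proof (intro conjI allI impI)
  define c where "c = 2 * l + 2"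
  have c: "c > 0" "2 * real l + 2 = real c" by (simp_all add: c_def)
  \<comment> \<open>Chosen so that, for \<open>m \<ge> 1\<close>, the left side is exactly
    \<open>4 * (m div c) ^ (l + 1)\<close>.\<close>
  define \<epsilon> where "\<epsilon> m = (real (m div c) * real c / real m) ^ (l + 1) - 1" for m
  have "\<epsilon> \<longlonglongrightarrow> 1 ^ (l + 1) - 1"
    unfolding \<epsilon>_def using c by (intro tendsto_intros tendsto_div_mult_divide)
  then have "\<epsilon> \<longlonglongrightarrow> 0" by simp
  moreover have "(1 + \<epsilon> m) * 4 * (real m ^ (l + 1) / (2 * real l + 2) ^ (l + 1))
      \<le> real (rho (path_graph (2 * l + 1)) m)" if "m \<ge> 1" for m
  proof -
    have "(1 + \<epsilon> m) * 4 * (real m ^ (l + 1) / (2 * real l + 2) ^ (l + 1))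
        = 4 * (real (m div c) * real c / real m * real m / real c) ^ (l + 1)"
      unfolding \<epsilon>_def c(2) power_divide power_mult_distrib by simp
    also have "\<dots> = real (4 * (m div c) ^ (l + 1))"
      using that c(1) by simp
    also have "\<dots> \<le> real (rho (path_graph (2 * l + 1)) m)"
      unfolding c_def using assms by (intro of_nat_mono rho_path_ge) simp
    finally show ?thesis .
  qed
  ultimately show "\<exists>\<epsilon> :: nat \<Rightarrow> real. \<epsilon> \<longlonglongrightarrow> 0 \<and>
      (\<forall>m::nat. m \<ge> 1 \<longrightarrow>
        (1 + \<epsilon> m) * 4 * (real m ^ (l + 1) / (2 * real l + 2) ^ (l + 1))
          \<le> real (rho (path_graph (2 * l + 1)) m))"
    by blast
next
  fix m :: nat
  let ?X = "{induced_copies G (path_graph (2 * l + 1)) | G :: nat graph.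
    simple_graph G \<and> card (edges G) = m}"
  have "finite ?X" using assms by (intro finite_induced_copies_path) simp
  moreover have "?X \<noteq> {}" using rho_path_ge(2)[of l m] assms by auto
  \<comment> \<open>The maximum is attained by some graph, to which the bound for a single host
    applies.\<close>
  ultimately have "rho (path_graph (2 * l + 1)) m \<in> ?X"
    unfolding rho_def by (rule Max_in)
  then show "real (rho (path_graph (2 * l + 1)) m) \<le> real m ^ (l + 1) / (4 * real l ^ l)"
    using induced_copies_path_le[OF _ _ assms] by fastforce
qed

end
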